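(* Let $\mathscr{R}$ be a ring and $U$ a finite set with $n$ elements. Given, for each $i\in U$, a function $f_i\colon 2^U\to\mathscr{R}$, the multi-subset transform $g\colon 2^U\to\mathscr{R}$ of $(f_i)_{i\in U}$, defined by $$g(T)=\sum_{S\subseteq T}\ \prod_{i\in T} f_i(S),\qquad T\subseteq U,$$ can be computed using $O(2.985^n)$ arithmetic operations.
   Context: $2^U$ denotes the family of all subsets of $U$. Arithmetic operations are additions (subtractions) and multiplications in the ring $\mathscr{R}$; the input consists of the values $f_i(S)$ for all $i\in U$, $S\subseteq U$, and the output consists of the values $g(T)$ for all $T\subseteq U$. *)

theory Defs
  imports Complex_Main "HOL-Library.Landau_Symbols"
begin

text \<open>
  Cost model: straight-line programs over a commutative ring.  Each instruction performs one ring
  operation and stores the result in the next register, so the number of arithmetic operations is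
  the length of the program.  Reading an input, a register or one of the constants 0 and 1 is free;
  any other ring constant has to be computed.  (The constant 1 cannot be avoided: the transform has
  the value 1 at the empty set, even if there are no inputs at all.)
\<close>

datatype 'i operand = Zero | One | Input 'i | Reg nat

datatype 'i instr =
    Add "'i operand" "'i operand"
  | Sub "'i operand" "'i operand"
  | Mul "'i operand" "'i operand"

type_synonym 'i program = "'i instr list"

text \<open>The list \<open>rs\<close> holds the registers written so far; a register not yet written reads as 0.\<close>

fun operand_val :: "('i \<Rightarrow> 'a::comm_ring_1) \<Rightarrow> 'a list \<Rightarrow> 'i operand \<Rightarrow> 'a" where
  "operand_val x rs Zero = 0"
| "operand_val x rs One = 1"
| "operand_val x rs (Input i) = x i"
| "operand_val x rs (Reg k) = (if k < length rs then rs ! k else 0)"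

fun instr_val :: "('i \<Rightarrow> 'a::comm_ring_1) \<Rightarrow> 'a list \<Rightarrow> 'i instr \<Rightarrow> 'a" where
  "instr_val x rs (Add a b) = operand_val x rs a + operand_val x rs b"
| "instr_val x rs (Sub a b) = operand_val x rs a - operand_val x rs b"
| "instr_val x rs (Mul a b) = operand_val x rs a * operand_val x rs b"

definition run :: "('i \<Rightarrow> 'a::comm_ring_1) \<Rightarrow> 'i program \<Rightarrow> 'a list" where
  "run x P = foldl (\<lambda>rs c. rs @ [instr_val x rs c]) [] P"

text \<open>
  Program \<open>P\<close> computes the outputs \<open>F x j\<close>, for \<open>j \<in> J\<close>, from the inputs \<open>x i\<close>, for \<open>i \<in> I\<close>.
  The program and the location \<open>out j\<close> of each output are the same for all input values \<open>x\<close>.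
\<close>

definition computes ::
  "'i set \<Rightarrow> 'o set \<Rightarrow> (('i \<Rightarrow> 'a::comm_ring_1) \<Rightarrow> 'o \<Rightarrow> 'a) \<Rightarrow> 'i program \<Rightarrow> bool" where
  "computes I J F P \<longleftrightarrow>
     (\<forall>c\<in>set P. set_instr c \<subseteq> I) \<and>
     (\<exists>out :: 'o \<Rightarrow> 'i operand.
        \<forall>j\<in>J. set_operand (out j) \<subseteq> I \<and> (\<forall>x. operand_val x (run x P) (out j) = F x j))"

definition multi_subset_transform ::
  "('u \<Rightarrow> 'u set \<Rightarrow> 'a::comm_ring_1) \<Rightarrow> 'u set \<Rightarrow> 'a" where
  "multi_subset_transform f T = (\<Sum>S\<in>Pow T. \<Prod>i\<in>T. f i S)"

end

(*
  Split U into A and B with |A| about 2n/3 and |B| about n/3.  With M(P, S) the product of f_i(S)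
  over i in P, the transform is g(T) = sum over S <= T of M(T Int A, S) M(T Int B, S), a matrix
  product in which entries are missing.  It is computed recursively, three elements at a time: two
  elements a1, a2 of A and one element b of B.  Restricting T and S to {a1, a2, b} gives 27
  pairs Y <= X, hence 27 recursive products.  Eight of them form a complete product of 2-by-2
  block matrices, for which Strassen's identities need only 7 products.  So three elements cost a
  factor 26 rather than 27, and 26 < 2.985^3.  The additions on the two factors
  cost a factor of at most 3 * 3 * 2 = 18 per three elements, since M(P, S) is only needed
  when S Int A <= P; they are dominated by the recursion.
*)

theory Submission
  imports Defs "HOL-Library.Function_Algebras"
begin

section \<open>Counting ring operations on sets of available elements\<close>

text \<open>Tracking the set of elements available so far, instead of registers, makes reuse free
  and removes all bookkeeping of addresses; registers return only in
  \<open>program_of_ring_ops\<close>.\<close>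

inductive ring_ops :: "'r::comm_ring_1 set \<Rightarrow> nat \<Rightarrow> 'r set \<Rightarrow> bool" for V where
  init: "ring_ops V 0 V"
| step: "ring_ops V c W \<Longrightarrow> a \<in> W \<Longrightarrow> b \<in> W \<Longrightarrow> r \<in> {a + b, a - b, a * b}
          \<Longrightarrow> ring_ops V (Suc c) (insert r W)"

lemma ring_ops_superset: "ring_ops V c W \<Longrightarrow> V \<subseteq> W"
  by (induction rule: ring_ops.induct) auto

lemma ring_ops_mono:
  assumes "ring_ops V c W" "V \<subseteq> V'"
  shows "ring_ops V' c (W \<union> V')"
  using assms(1)
proof induction
  case init
  show ?case using ring_ops.init[of V'] assms(2) by (simp add: Un_absorb1)
next
  case (step c W a b r)
  show ?case using ring_ops.step[OF step.IH, of a b r] step.hyps by simp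
qed

lemma ring_ops_trans:
  assumes "ring_ops W d Z" "ring_ops V c W"
  shows "ring_ops V (c + d) Z"
  using assms by induction (auto intro: ring_ops.step)

text \<open>The larger set \<open>Z\<close> leaves room for intermediate results, and
  \<open>d \<le> c\<close> makes the cost an upper bound.\<close>

definition cost_le :: "'r::comm_ring_1 set \<Rightarrow> nat \<Rightarrow> 'r set \<Rightarrow> bool" where
  "cost_le V c W \<longleftrightarrow> (\<exists>d Z. d \<le> c \<and> W \<subseteq> Z \<and> ring_ops V d Z)"

lemma cost_le_subset: "W \<subseteq> V \<Longrightarrow> cost_le V c W"
  unfolding cost_le_def using ring_ops.init by blast

lemma cost_le_mono:
  assumes "cost_le V c W" "V \<subseteq> V'" "c \<le> c'" "W' \<subseteq> W"
  shows "cost_le V' c' W'"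
proof -
  obtain d Z where "d \<le> c" "W \<subseteq> Z" "ring_ops V d Z" using assms(1) unfolding cost_le_def by blast
  then show ?thesis using ring_ops_mono[of V d Z V'] assms unfolding cost_le_def
    by (intro exI[of _ d] exI[of _ "Z \<union> V'"]) auto
qed

text \<open>The first computation ends with at least \<open>V \<union> W\<close> available, and by
  \<open>ring_ops_mono\<close> the second can be replayed from any larger starting set.\<close>

lemma cost_le_trans:
  assumes "cost_le V c W" "cost_le (V \<union> W) d W'"
  shows "cost_le V (c + d) (W \<union> W')"
proof -
  obtain c0 Z where 1: "c0 \<le> c" "W \<subseteq> Z" "ring_ops V c0 Z"
    using assms(1) unfolding cost_le_def by blast
  obtain d0 Y where 2: "d0 \<le> d" "W' \<subseteq> Y" "ring_ops (V \<union> W) d0 Y"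
    using assms(2) unfolding cost_le_def by blast
  have "V \<union> W \<subseteq> Z" using 1 ring_ops_superset by blast
  then have "ring_ops Z d0 (Y \<union> Z)" by (rule ring_ops_mono[OF 2(3)])
  then have "ring_ops V (c0 + d0) (Y \<union> Z)" using 1(3) by (rule ring_ops_trans)
  moreover have "c0 + d0 \<le> c + d" "W \<union> W' \<subseteq> Y \<union> Z" using 1 2 by auto
  ultimately show ?thesis unfolding cost_le_def by blast
qed

lemma cost_le_trans':
  assumes "cost_le V c W" "cost_le (V \<union> W) d W'"
  shows "cost_le V (c + d) W'"
  using cost_le_mono[OF cost_le_trans[OF assms]] by blast

lemma cost_le_Un:
  assumes "cost_le V c W" "cost_le V d W'"
  shows "cost_le V (c + d) (W \<union> W')"
  using cost_le_trans[OF assms(1)] cost_le_mono[OF assms(2)] by blast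

lemma cost_le_UN:
  assumes "finite J" "\<And>j. j \<in> J \<Longrightarrow> cost_le V c (W j)"
  shows "cost_le V (card J * c) (\<Union>j\<in>J. W j)"
  using assms
proof (induction J)
  case empty
  then show ?case by (simp add: cost_le_subset)
next
  case (insert j J)
  then show ?case using cost_le_Un[of V c "W j" "card J * c" "\<Union>j\<in>J. W j"] by simp
qed

lemma cost_le_image:
  assumes "finite J" "\<And>j. j \<in> J \<Longrightarrow> cost_le V c {f j}"
  shows "cost_le V (card J * c) (f ` J)"
  using cost_le_UN[of J V c "\<lambda>j. {f j}"] assms by (simp add: UNION_singleton_eq_range)

lemma cost_le_op:
  assumes "cost_le V c {a}" "cost_le V d {b}" "r \<in> {a + b, a - b, a * b}"
  shows "cost_le V (Suc (c + d)) {r}"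
proof -
  obtain e Z where "e \<le> c + d" "{a} \<union> {b} \<subseteq> Z" "ring_ops V e Z"
    using cost_le_Un[OF assms(1,2)] unfolding cost_le_def by blast
  then show ?thesis using ring_ops.step[of V e Z a b r] assms(3) unfolding cost_le_def
    by (intro exI[of _ "Suc e"] exI[of _ "insert r Z"]) auto
qed

lemmas cost_le_add = cost_le_op[of V c a d b "a + b" for V c a d b, simplified]
lemmas cost_le_diff = cost_le_op[of V c a d b "a - b" for V c a d b, simplified]
lemmas cost_le_mult = cost_le_op[of V c a d b "a * b" for V c a d b, simplified]

text \<open>Every summand, the first one included, is added to a partial sum that starts at 0; hence
  the count \<open>card J\<close> and the condition \<open>0 \<in> V\<close>.\<close>

lemma cost_le_sum:
  assumes "finite J" "0 \<in> V" "f ` J \<subseteq> V"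
  shows "cost_le V (card J) {sum f J}"
  using assms
proof (induction J)
  case empty
  then show ?case by (simp add: cost_le_subset)
next
  case (insert j J)
  have "cost_le V 0 {f j}" using insert.prems by (intro cost_le_subset) auto
  then show ?case using cost_le_add[of V 0 "f j" "card J" "sum f J"] insert by simp
qed

lemma cost_le_prod:
  assumes "finite J" "1 \<in> V" "f ` J \<subseteq> V"
  shows "cost_le V (card J) {prod f J}"
  using assms
proof (induction J)
  case empty
  then show ?case by (simp add: cost_le_subset)
next
  case (insert j J)
  have "cost_le V 0 {f j}" using insert.prems by (intro cost_le_subset) auto
  then show ?case using cost_le_mult[of V 0 "f j" "card J" "prod f J"] insert by simp
qed

section \<open>From available elements to straight-line programs\<close>

text \<open>The starting set lies in the ring of functions of the input \<open>x\<close> with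
  pointwise operations. An equation in this ring holds for all inputs at once, so a single
  computation serves every \<open>x\<close>.\<close>

definition input_functions :: "'i set \<Rightarrow> (('i \<Rightarrow> 'a::comm_ring_1) \<Rightarrow> 'a) set" where
  "input_functions I = {0, 1} \<union> (\<lambda>i x. x i) ` I"

text \<open>
  The register bound is needed because an unwritten register reads as 0 only until it is written.
\<close>

definition stored ::
    "'i set \<Rightarrow> 'i program \<Rightarrow> 'i operand \<Rightarrow> (('i \<Rightarrow> 'a::comm_ring_1) \<Rightarrow> 'a) \<Rightarrow> bool" where
  "stored I P b f \<longleftrightarrow> set_operand b \<subseteq> I \<and> (\<forall>k. b = Reg k \<longrightarrow> k < length P) \<and>
     (\<forall>x. operand_val x (run x P) b = f x)"

lemma run_snoc: "run x (P @ [c]) = run x P @ [instr_val x (run x P) c]"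
  by (simp add: run_def)

lemma length_run [simp]: "length (run x P) = length P"
  by (induction P rule: rev_induct) (simp_all add: run_snoc, simp add: run_def)

lemma stored_snoc: "stored I P b f \<Longrightarrow> stored I (P @ [c]) b f"
  unfolding stored_def by (cases b) (auto simp: run_snoc nth_append)

text \<open>Each step appends one instruction, whose result sits in register
  \<open>length P\<close>. Registers are never overwritten, so operands located earlier stay valid
  (\<open>stored_snoc\<close>).\<close>

lemma program_of_ring_ops:
  assumes "ring_ops (input_functions I :: (('i \<Rightarrow> 'a::comm_ring_1) \<Rightarrow> 'a) set) c W"
  shows "\<exists>P. length P = c \<and> (\<forall>c\<in>set P. set_instr c \<subseteq> I) \<and> (\<forall>f\<in>W. \<exists>b. stored I P b f)"
  using assms
proof induction
  case init
  have "\<exists>b. stored I [] b f" if f: "f \<in> input_functions I" for f :: "('i \<Rightarrow> 'a) \<Rightarrow> 'a"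
  proof -
    consider "f = 0" | "f = 1" | i where "i \<in> I" "f = (\<lambda>x. x i)"
      using f unfolding input_functions_def by auto
    then show ?thesis
    proof cases
      case 1 then show ?thesis by (intro exI[of _ Zero]) (simp add: stored_def)
    next
      case 2 then show ?thesis by (intro exI[of _ One]) (simp add: stored_def)
    next
      case 3 then show ?thesis by (intro exI[of _ "Input i"]) (simp add: stored_def)
    qed
  qed
  then show ?case by (intro exI[of _ "[]"]) simp
next
  case (step c W a b r)
  obtain P where P: "length P = c" "\<forall>c\<in>set P. set_instr c \<subseteq> I" "\<forall>f\<in>W. \<exists>b. stored I P b f"
    using step.IH by blast
  obtain p q where pq: "stored I P p a" "stored I P q b" using P(3) step.hyps by blast
  have "\<exists>e. set_instr e \<subseteq> I \<and> (\<forall>x. instr_val x (run x P) e = r x)"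
  proof -
    consider "r = a + b" | "r = a - b" | "r = a * b" using step.hyps(4) by blast
    then show ?thesis
    proof cases
      case 1 then show ?thesis using pq by (intro exI[of _ "Add p q"]) (simp add: stored_def)
    next
      case 2 then show ?thesis using pq by (intro exI[of _ "Sub p q"]) (simp add: stored_def)
    next
      case 3 then show ?thesis using pq by (intro exI[of _ "Mul p q"]) (simp add: stored_def)
    qed
  qed
  then obtain e where e: "set_instr e \<subseteq> I" "\<And>x. instr_val x (run x P) e = r x" by blast
  have "stored I (P @ [e]) (Reg (length P)) r"
    using e by (simp add: stored_def run_snoc nth_append)
  then have "\<forall>f\<in>insert r W. \<exists>b. stored I (P @ [e]) b f"
    using P(3) stored_snoc by blast
  then show ?case using P(1,2) e(1) by (intro exI[of _ "P @ [e]"]) auto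
qed

lemma computes_of_cost_le:
  assumes "cost_le (input_functions I) c ((\<lambda>j x. F x j) ` J)"
  shows "\<exists>P. length P \<le> c \<and> computes I J F P"
proof -
  obtain d W where W: "d \<le> c" "(\<lambda>j x. F x j) ` J \<subseteq> W" "ring_ops (input_functions I) d W"
    using assms unfolding cost_le_def by blast
  obtain P where P: "length P = d" "\<forall>c\<in>set P. set_instr c \<subseteq> I"
      "\<forall>f\<in>W. \<exists>b. stored I P b f"
    using program_of_ring_ops[OF W(3)] by blast
  have "\<forall>j\<in>J. \<exists>b. stored I P b (\<lambda>x. F x j)" using P(3) W(2) by blast
  then obtain out where "\<forall>j\<in>J. stored I P (out j) (\<lambda>x. F x j)" by metis
  then have "computes I J F P" using P(2) unfolding computes_def stored_def by blast
  then show ?thesis using P(1) W(1) by blast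
qed

section \<open>Masked products and the sizes of their index sets\<close>

text \<open>
  The pairs \<open>(T \<inter> A, S)\<close> with \<open>S \<subseteq> T\<close>: the only entries of the left factor that the product uses.
\<close>

definition mask :: "'u set \<Rightarrow> 'u set \<Rightarrow> ('u set \<times> 'u set) set" where
  "mask A B = {(P, S). P \<subseteq> A \<and> S \<subseteq> A \<union> B \<and> S \<inter> A \<subseteq> P}"

text \<open>Each element of \<open>A\<close> has three choices: in both sets, in the larger one
  only, or in neither.\<close>

lemma card_subset_pairs:
  assumes "finite A"
  shows "card (SIGMA X:Pow A. Pow X) = 3 ^ card A"
proof -
  have "(\<Sum>X\<in>Pow A. (2::nat) ^ card X) = 3 ^ card A"
    using assms
  proof (induction A)
    case empty
    then show ?case by simp
  next
    case (insert a A)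
    have inj: "inj_on (insert a) (Pow A)" using insert.hyps by (auto simp: inj_on_def)
    have disj: "Pow A \<inter> insert a ` Pow A = {}" using insert.hyps by auto
    have "(\<Sum>X\<in>Pow A. (2::nat) ^ card (insert a X)) = (\<Sum>X\<in>Pow A. 2 * 2 ^ card X)"
      using insert.hyps by (intro sum.cong) (auto simp: card_insert_if finite_subset)
    then show ?case using insert disj
      by (simp add: Pow_insert sum.union_disjoint sum.reindex[OF inj] sum_distrib_left[symmetric])
  qed
  moreover have "card (SIGMA X:Pow A. Pow X) = (\<Sum>X\<in>Pow A. 2 ^ card X)"
    using assms by (subst card_SigmaI) (auto simp: card_Pow finite_subset)
  ultimately show ?thesis by simp
qed

text \<open>A pair \<open>(P, S)\<close> is determined by the nested pair
  \<open>S \<inter> A \<subseteq> P\<close> in \<open>A\<close> and the free subset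
  \<open>S \<inter> B\<close> of \<open>B\<close>.\<close>

lemma card_mask:
  assumes "finite A" "finite B"
  shows "finite (mask A B)" "card (mask A B) \<le> 3 ^ card A * 2 ^ card B"
proof -
  let ?f = "\<lambda>(P, S). ((P, S \<inter> A), S \<inter> B)"
  let ?Z = "(SIGMA X:Pow A. Pow X) \<times> Pow B"
  have inj: "inj_on ?f (mask A B)"
    unfolding inj_on_def mask_def by (clarsimp) blast
  have sub: "?f ` mask A B \<subseteq> ?Z" unfolding mask_def by auto
  have fin: "finite ?Z" using assms
    by (intro finite_cartesian_product finite_SigmaI) (auto intro: finite_subset)
  show "finite (mask A B)" using finite_imageD[OF finite_subset[OF sub fin] inj] .
  have "card (mask A B) \<le> card ?Z" using card_inj_on_le[OF inj sub fin] .
  then show "card (mask A B) \<le> 3 ^ card A * 2 ^ card B"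
    using assms by (simp add: card_cartesian_product card_subset_pairs card_Pow)
qed

text \<open>Rows are indexed by \<open>T \<inter> A\<close>, columns by \<open>T \<inter> B\<close>,
  and \<open>S\<close> is the inner index. Its range depends on row and column, so fast matrix
  multiplication does not apply directly.\<close>

definition masked_product ::
    "'u set \<Rightarrow> 'u set \<Rightarrow> ('u set \<Rightarrow> 'u set \<Rightarrow> 'r) \<Rightarrow> ('u set \<Rightarrow> 'u set \<Rightarrow> 'r) \<Rightarrow> 'u set \<Rightarrow> 'r::comm_ring_1"
  where "masked_product A B M N T = (\<Sum>S\<in>Pow T. M (T \<inter> A) S * N (T \<inter> B) S)"

text \<open>Bilinearity is all that Strassen's identities require of the products of blocks.\<close>

lemma masked_product_linear:
  "masked_product A B (\<lambda>P S. M P S + M' P S) N T = masked_product A B M N T + masked_product A B M' N T"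
  "masked_product A B (\<lambda>P S. M P S - M' P S) N T = masked_product A B M N T - masked_product A B M' N T"
  "masked_product A B M (\<lambda>P S. N P S + N' P S) T = masked_product A B M N T + masked_product A B M N' T"
  "masked_product A B M (\<lambda>P S. N P S - N' P S) T = masked_product A B M N T - masked_product A B M N' T"
  by (simp_all add: masked_product_def algebra_simps sum.distrib sum_subtractf)

definition entries_in ::
    "'u set \<Rightarrow> 'u set \<Rightarrow> 'r set \<Rightarrow> ('u set \<Rightarrow> 'u set \<Rightarrow> 'r) \<Rightarrow> bool" where
  "entries_in A B V M \<longleftrightarrow> (\<forall>(P, S)\<in>mask A B. M P S \<in> V)"

text \<open>Quantifying over arbitrary \<open>M\<close> and \<open>N\<close> lets the bound apply to
  sums and differences of blocks as well. The right factor is indexed by \<open>B\<close>, so its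
  mask has \<open>A\<close> and \<open>B\<close> exchanged. The type argument fixes the
  ring.\<close>

definition product_cost :: "'r::comm_ring_1 itself \<Rightarrow> 'u set \<Rightarrow> 'u set \<Rightarrow> nat \<Rightarrow> bool" where
  "product_cost R A B c \<longleftrightarrow> (\<forall>V (M :: _ \<Rightarrow> _ \<Rightarrow> 'r) N. 0 \<in> V \<longrightarrow> entries_in A B V M \<longrightarrow>
     entries_in B A V N \<longrightarrow> cost_le V c (masked_product A B M N ` Pow (A \<union> B)))"

lemma product_costD:
  "product_cost TYPE('r::comm_ring_1) A B c \<Longrightarrow> 0 \<in> V \<Longrightarrow> entries_in A B V (M :: _ \<Rightarrow> _ \<Rightarrow> 'r) \<Longrightarrow>
    entries_in B A V N \<Longrightarrow> cost_le V c (masked_product A B M N ` Pow (A \<union> B))"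
  unfolding product_cost_def by blast

text \<open>As \<open>T\<close> and \<open>X\<close> are disjoint, a subset of
  \<open>T \<union> X\<close> is uniquely \<open>S \<union> Y\<close> with
  \<open>S \<subseteq> T\<close> and \<open>Y \<subseteq> X\<close>. For fixed \<open>X\<close> and
  \<open>Y\<close>, what remains is a masked product over the smaller ground set.\<close>

lemma masked_product_split:
  assumes fin: "finite T" "finite X" and T: "T \<subseteq> A \<union> B" and X: "X \<subseteq> A' \<union> B'"
    and disj: "(A \<union> B) \<inter> (A' \<union> B') = {}"
  shows "masked_product (A \<union> A') (B \<union> B') M N (T \<union> X) =
    (\<Sum>Y\<in>Pow X. masked_product A B (\<lambda>P S. M (P \<union> (X \<inter> A')) (S \<union> Y))
       (\<lambda>Q S. N (Q \<union> (X \<inter> B')) (S \<union> Y)) T)"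
proof -
  have TA: "(T \<union> X) \<inter> (A \<union> A') = (T \<inter> A) \<union> (X \<inter> A')"
    "(T \<union> X) \<inter> (B \<union> B') = (T \<inter> B) \<union> (X \<inter> B')" using T X disj by blast+
  let ?h = "\<lambda>Z. M ((T \<inter> A) \<union> (X \<inter> A')) Z * N ((T \<inter> B) \<union> (X \<inter> B')) Z"
  have "T \<inter> X = {}" using T X disj by blast
  then have "(\<Sum>Z\<in>Pow (T \<union> X). ?h Z) = (\<Sum>(Y, S)\<in>Pow X \<times> Pow T. ?h (S \<union> Y))"
    by (intro sum.reindex_bij_witness[where i = "\<lambda>(Y, S). S \<union> Y" and j = "\<lambda>Z. (Z \<inter> X, Z \<inter> T)"])
      (auto simp: Int_Un_distrib2[symmetric] Un_commute Int_absorb2 Int_Un_distrib[symmetric])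
  then show ?thesis
    unfolding masked_product_def TA by (simp add: sum.cartesian_product)
qed

lemma entries_in_block:
  assumes "entries_in (A \<union> A') (B \<union> B') V M" "X \<subseteq> A' \<union> B'" "Y \<subseteq> X"
    "(A \<union> B) \<inter> (A' \<union> B') = {}"
  shows "entries_in A B V (\<lambda>P S. M (P \<union> (X \<inter> A')) (S \<union> Y))"
  unfolding entries_in_def
proof clarify
  fix P S assume "(P, S) \<in> mask A B"
  then have "(P \<union> (X \<inter> A'), S \<union> Y) \<in> mask (A \<union> A') (B \<union> B')"
    using assms(2-4) unfolding mask_def by auto
  then show "M (P \<union> (X \<inter> A')) (S \<union> Y) \<in> V" using assms(1) unfolding entries_in_def by auto
qed

lemma entries_in_mono: "entries_in A B V M \<Longrightarrow> V \<subseteq> W \<Longrightarrow> entries_in A B W M"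
  unfolding entries_in_def by blast

section \<open>Strassen's identities for 2-by-2 blocks of masked products\<close>

lemma cost_le_entries:
  assumes "finite A" "finite B" "entries_in A B V M" "entries_in A B V M'"
    and "\<And>P S. L P S = M P S + M' P S \<or> L P S = M P S - M' P S"
  shows "cost_le V (card (mask A B)) ((\<lambda>(P, S). L P S) ` mask A B)"
proof -
  have "cost_le V 1 {case z of (P, S) \<Rightarrow> L P S}" if z: "z \<in> mask A B" for z
  proof -
    obtain P S where [simp]: "z = (P, S)" by (cases z)
    have "M P S \<in> V" "M' P S \<in> V" using z assms(3,4) unfolding entries_in_def by auto
    then show ?thesis
      using assms(5)[of P S] cost_le_op[of V 0 "M P S" 0 "M' P S" "L P S"]
      by (auto simp: cost_le_subset)
  qed
  then show ?thesis
    using cost_le_image[OF card_mask(1)[OF assms(1,2)], of V 1 "\<lambda>(P, S). L P S"] by simp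
qed

text \<open>All blocks share one mask, so their linear combinations are again valid factors. Five
  combinations are formed on each side; the 7 products are then combined into
  \<open>4 * 2 ^ card (A \<union> B)\<close> outputs with at most 3 operations each.\<close>

lemma cost_le_strassen:
  fixes M N :: "bool \<Rightarrow> bool \<Rightarrow> 'u set \<Rightarrow> 'u set \<Rightarrow> 'r::comm_ring_1"
  assumes fin: "finite A" "finite B" and pc: "product_cost TYPE('r) A B c" and V: "0 \<in> V"
    and M: "\<And>i j. entries_in A B V (M i j)" and N: "\<And>j l. entries_in B A V (N j l)"
  shows "cost_le V (7 * c + 5 * card (mask A B) + 5 * card (mask B A) + 12 * 2 ^ card (A \<union> B))
    ((\<lambda>(i, l, T). masked_product A B (M i False) (N False l) T + masked_product A B (M i True) (N True l) T)
       ` (UNIV \<times> UNIV \<times> Pow (A \<union> B)))"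
\<comment> \<open>The numbering follows Strassen's products \<open>m1\<close> to \<open>m7\<close>,
  with \<open>False\<close> and \<open>True\<close> as block indices 1 and 2. Products 3 and 4 use a
  single block on the left, products 2 and 5 a single block on the right.\<close>
proof -
  define L1 where "L1 = (\<lambda>P S. M False False P S + M True True P S)"
  define L2 where "L2 = (\<lambda>P S. M True False P S + M True True P S)"
  define L5 where "L5 = (\<lambda>P S. M False False P S + M False True P S)"
  define L6 where "L6 = (\<lambda>P S. M True False P S - M False False P S)"
  define L7 where "L7 = (\<lambda>P S. M False True P S - M True True P S)"
  define R1 where "R1 = (\<lambda>P S. N False False P S + N True True P S)"
  define R3 where "R3 = (\<lambda>P S. N False True P S - N True True P S)"
  define R4 where "R4 = (\<lambda>P S. N True False P S - N False False P S)"
  define R6 where "R6 = (\<lambda>P S. N False False P S + N False True P S)"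
  define R7 where "R7 = (\<lambda>P S. N True False P S + N True True P S)"
  note L_defs = L1_def L2_def L5_def L6_def L7_def and R_defs = R1_def R3_def R4_def R6_def R7_def
  let ?L = "\<lambda>L. (\<lambda>(P, S). L P S) ` mask A B" and ?R = "\<lambda>R. (\<lambda>(P, S). R P S) ` mask B A"
  let ?m = "card (mask A B)" and ?n = "card (mask B A)"
  define W where "W = (?L L1 \<union> ?L L2 \<union> ?L L5 \<union> ?L L6 \<union> ?L L7) \<union> (?R R1 \<union> ?R R3 \<union> ?R R4 \<union> ?R R6 \<union> ?R R7)"
  have L: "cost_le V ?m (?L L)" if "L \<in> {L1, L2, L5, L6, L7}" for L
    using that cost_le_entries[OF fin M M, of L] unfolding L_defs by blast
  have R: "cost_le V ?n (?R R)" if "R \<in> {R1, R3, R4, R6, R7}" for R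
    using that cost_le_entries[OF fin(2,1) N N, of R] unfolding R_defs by blast
  have W: "cost_le V ((?m + ?m + ?m + ?m + ?m) + (?n + ?n + ?n + ?n + ?n)) W"
    unfolding W_def by (intro cost_le_Un L R) auto
  define V1 where "V1 = V \<union> W"
  have inL: "entries_in A B V1 L" if "L \<in> {L1, L2, L5, L6, L7}" for L
    using that unfolding entries_in_def V1_def W_def by fastforce
  have inR: "entries_in B A V1 R" if "R \<in> {R1, R3, R4, R6, R7}" for R
    using that unfolding entries_in_def V1_def W_def by fastforce
  have M1: "entries_in A B V1 (M i j)" for i j
    using entries_in_mono[OF M] unfolding V1_def by blast
  have N1: "entries_in B A V1 (N i j)" for i j
    using entries_in_mono[OF N] unfolding V1_def by blast
  have V10: "0 \<in> V1" using V unfolding V1_def by blast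
  let ?p = "\<lambda>L R. masked_product A B L R ` Pow (A \<union> B)"
  define Z where "Z = ?p L1 R1 \<union> ?p L2 (N False False) \<union> ?p (M False False) R3 \<union> ?p (M True True) R4
    \<union> ?p L5 (N True True) \<union> ?p L6 R6 \<union> ?p L7 R7"
  have Z: "cost_le V1 (c + c + c + c + c + c + c) Z"
    unfolding Z_def by (intro cost_le_Un product_costD[OF pc V10] inL inR M1 N1) auto
  define V2 where "V2 = V1 \<union> Z"
  let ?C = "\<lambda>(i, l, T). masked_product A B (M i False) (N False l) T + masked_product A B (M i True) (N True l) T"
  have "cost_le V2 3 {?C x}" if x: "x \<in> UNIV \<times> UNIV \<times> Pow (A \<union> B)" for x
  proof -
    obtain i l T where [simp]: "x = (i, l, T)" by (cases x)
    let ?q = "\<lambda>L R. masked_product A B L R T"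
    define m1 m2 m3 m4 m5 m6 m7 where m: "m1 = ?q L1 R1" "m2 = ?q L2 (N False False)"
      "m3 = ?q (M False False) R3" "m4 = ?q (M True True) R4" "m5 = ?q L5 (N True True)"
      "m6 = ?q L6 R6" "m7 = ?q L7 R7"
    have "{m1, m2, m3, m4, m5, m6, m7} \<subseteq> V2"
      using x unfolding V2_def Z_def m by auto
    then have m0: "cost_le V2 0 {m1}" "cost_le V2 0 {m2}" "cost_le V2 0 {m3}" "cost_le V2 0 {m4}"
      "cost_le V2 0 {m5}" "cost_le V2 0 {m6}" "cost_le V2 0 {m7}" by (auto intro: cost_le_subset)
    have eq: "?C (False, False, T) = m1 + m4 - m5 + m7" "?C (False, True, T) = m3 + m5"
      "?C (True, False, T) = m2 + m4" "?C (True, True, T) = m1 - m2 + m3 + m6"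
      unfolding m L_defs R_defs by (simp_all add: masked_product_linear algebra_simps)
    have "cost_le V2 (Suc (Suc (Suc (0 + 0) + 0) + 0)) {m1 + m4 - m5 + m7}"
      "cost_le V2 (Suc (0 + 0)) {m3 + m5}" "cost_le V2 (Suc (0 + 0)) {m2 + m4}"
      "cost_le V2 (Suc (Suc (Suc (0 + 0) + 0) + 0)) {m1 - m2 + m3 + m6}"
      by (intro cost_le_add cost_le_diff m0)+
    then have "cost_le V2 3 {?C (i, l, T)}"
      unfolding eq[symmetric] by (cases i; cases l) (auto intro: cost_le_mono[OF _ order_refl _ order_refl])
    then show ?thesis by simp
  qed
  then have "cost_le V2 (card (UNIV \<times> UNIV \<times> Pow (A \<union> B) :: (bool \<times> bool \<times> 'u set) set) * 3)
      (?C ` (UNIV \<times> UNIV \<times> Pow (A \<union> B)))"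
    using fin by (intro cost_le_image) auto
  then have "cost_le V2 (12 * 2 ^ card (A \<union> B)) (?C ` (UNIV \<times> UNIV \<times> Pow (A \<union> B)))"
    using fin by (simp add: card_cartesian_product card_Pow)
  from cost_le_trans'[OF W[folded] cost_le_trans'[OF Z[unfolded V1_def] this[unfolded V2_def V1_def]]]
  show ?thesis by (rule cost_le_mono) auto
qed

section \<open>Enlarging the ground set by one or three elements\<close>

lemma product_cost_empty: "product_cost TYPE('r::comm_ring_1) ({} :: 'u set) {} 1"
  unfolding product_cost_def
proof (intro allI impI)
  fix V and M N :: "'u set \<Rightarrow> 'u set \<Rightarrow> 'r"
  assume "entries_in {} {} V M" "entries_in {} {} V N"
  then have "M {} {} \<in> V" "N {} {} \<in> V" by (auto simp: entries_in_def mask_def)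
  then have "cost_le V (Suc (0 + 0)) {M {} {} * N {} {}}"
    by (intro cost_le_mult cost_le_subset) auto
  then show "cost_le V 1 (masked_product {} {} M N ` Pow ({} \<union> {}))"
    by (simp add: masked_product_def)
qed

lemma product_cost_mono: "product_cost R A B c \<Longrightarrow> c \<le> c' \<Longrightarrow> product_cost R A B c'"
  unfolding product_cost_def using cost_le_mono by blast

text \<open>Each pair \<open>(X, Y)\<close> costs one smaller product. The selection
  \<open>K\<close> allows all pairs to be taken, or only those outside Strassen's block
  product.\<close>

lemma product_cost_blocks:
  assumes pc: "product_cost TYPE('r::comm_ring_1) A B c" and V: "0 \<in> V"
    and fin: "finite (A' \<union> B')"
    and M: "entries_in (A \<union> A') (B \<union> B') V (M :: _ \<Rightarrow> _ \<Rightarrow> 'r)"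
    and N: "entries_in (B \<union> B') (A \<union> A') V N"
    and disj: "(A \<union> B) \<inter> (A' \<union> B') = {}"
    and K: "K \<subseteq> (SIGMA X:Pow (A' \<union> B'). Pow X)"
  shows "cost_le V (card K * c)
    (\<Union>(X, Y)\<in>K. masked_product A B (\<lambda>P S. M (P \<union> (X \<inter> A')) (S \<union> Y))
       (\<lambda>Q S. N (Q \<union> (X \<inter> B')) (S \<union> Y)) ` Pow (A \<union> B))"
proof (rule cost_le_UN)
  show "finite K" using fin by (intro finite_subset[OF K] finite_SigmaI) (auto intro: finite_subset)
  show "cost_le V c (case k of (X, Y) \<Rightarrow>
      masked_product A B (\<lambda>P S. M (P \<union> (X \<inter> A')) (S \<union> Y))
       (\<lambda>Q S. N (Q \<union> (X \<inter> B')) (S \<union> Y)) ` Pow (A \<union> B))" if "k \<in> K" for k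
  proof -
    obtain X Y where [simp]: "k = (X, Y)" by (cases k)
    have XY: "X \<subseteq> A' \<union> B'" "Y \<subseteq> X" using that K by auto
    then have "X \<subseteq> B' \<union> A'" "(B \<union> A) \<inter> (B' \<union> A') = {}" using disj by auto
    then show ?thesis
      using product_costD[OF pc V entries_in_block[OF M XY disj]] entries_in_block[OF N _ XY(2)] by simp
  qed
qed

text \<open>Handles the at most two elements left over after grouping by threes. There are 3 pairs
  \<open>Y \<subseteq> X \<subseteq> {a}\<close>, and each of the
  \<open>2 * 2 ^ card (A \<union> B)\<close> outputs needs at most 2 additions.\<close>

lemma product_cost_insert:
  assumes pc: "product_cost TYPE('r::comm_ring_1) A B c" and fin: "finite A" "finite B"
    and a: "a \<notin> A \<union> B"
  shows "product_cost TYPE('r) (insert a A) B (3 * c + 4 * 2 ^ card (A \<union> B))"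
  unfolding product_cost_def
proof (intro allI impI)
  fix V and M N :: "'a set \<Rightarrow> 'a set \<Rightarrow> 'r"
  assume V: "0 \<in> V" and M: "entries_in (insert a A) B V M" and N: "entries_in B (insert a A) V N"
  let ?p = "\<lambda>X Y. masked_product A B (\<lambda>P S. M (P \<union> (X \<inter> {a})) (S \<union> Y)) (\<lambda>Q S. N (Q \<union> (X \<inter> {})) (S \<union> Y))"
  let ?K = "SIGMA X:Pow {a}. Pow X"
  have disj: "(A \<union> B) \<inter> ({a} \<union> {}) = {}" using a by simp
  define Z where "Z = (\<Union>(X, Y)\<in>?K. ?p X Y ` Pow (A \<union> B))"
  have "cost_le V (card ?K * c) Z" unfolding Z_def
    by (rule product_cost_blocks[OF pc V _ _ _ disj]) (use M N in auto)
  then have Z: "cost_le V (3 * c) Z" by (simp add: card_subset_pairs)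
  let ?J = "Pow {a} \<times> Pow (A \<union> B)"
  let ?g = "\<lambda>(X, T). masked_product (insert a A) B M N (T \<union> X)"
  have "cost_le (V \<union> Z) 2 {?g j}" if j: "j \<in> ?J" for j
  proof -
    obtain X T where [simp]: "j = (X, T)" by (cases j)
    have X: "X \<subseteq> {a} \<union> {}" "T \<subseteq> A \<union> B" using j by auto
    have finT: "finite T" "finite X" using X fin by (auto intro: finite_subset)
    have "?g j = (\<Sum>Y\<in>Pow X. ?p X Y T)"
      using masked_product_split[OF finT X(2,1) disj, of M N] by simp
    moreover have "cost_le (V \<union> Z) (card (Pow X)) {\<Sum>Y\<in>Pow X. ?p X Y T}"
      using X finT V by (intro cost_le_sum) (auto simp: Z_def)
    moreover have "card (Pow X) \<le> 2"
      using card_mono[of "{a}" X] X by (simp add: card_Pow finT) (cases "card X"; auto)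
    ultimately show ?thesis using cost_le_mono[of "V \<union> Z" _ _ "V \<union> Z" 2] by auto
  qed
  then have 1: "cost_le (V \<union> Z) (card ?J * 2) (?g ` ?J)"
    using fin by (intro cost_le_image) auto
  have 2: "card ?J * 2 = 4 * 2 ^ card (A \<union> B)"
    using fin by (simp add: card_cartesian_product card_Pow)
  have 3: "masked_product (insert a A) B M N ` Pow (insert a A \<union> B) \<subseteq> ?g ` ?J"
  proof (rule image_subsetI)
    fix T assume "T \<in> Pow (insert a A \<union> B)"
    then have "(T \<inter> {a}, T - {a}) \<in> ?J" "(T - {a}) \<union> (T \<inter> {a}) = T" by auto
    then show "masked_product (insert a A) B M N T \<in> ?g ` ?J" by (intro image_eqI[of _ _ "(T \<inter> {a}, T - {a})"]) simp_all
  qed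
  have "cost_le (V \<union> Z) (4 * 2 ^ card (A \<union> B))
      (masked_product (insert a A) B M N ` Pow (insert a A \<union> B))"
    by (rule cost_le_mono[OF 1 order_refl eq_refl[OF 2] 3])
  then show "cost_le V (3 * c + 4 * 2 ^ card (A \<union> B))
      (masked_product (insert a A) B M N ` Pow (insert a A \<union> B))"
    using cost_le_trans'[OF Z] by blast
qed

text \<open>
  The 19 sub-products indexed by \<open>K\<close> are computed one by one.  The other 8, those with
  \<open>a1 \<in> X\<close> and \<open>Y \<in> {{}, {a1}}\<close>, make up a full product of 2-by-2 block matrices, with
  rows indexed by \<open>a2 \<in> X\<close>, columns by \<open>b \<in> X\<close> and inner index \<open>a1 \<in> Y\<close>.
\<close>

lemma product_cost_triple:
  assumes pc: "product_cost TYPE('r::comm_ring_1) A B c" and fin: "finite A" "finite B"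
    and new: "{a1, a2, b} \<inter> (A \<union> B) = {}" and dist: "a1 \<noteq> a2" "a1 \<noteq> b" "a2 \<noteq> b"
  shows "product_cost TYPE('r) (A \<union> {a1, a2}) (B \<union> {b})
    (26 * c + 5 * card (mask A B) + 5 * card (mask B A) + 84 * 2 ^ card (A \<union> B))"
  unfolding product_cost_def
proof (intro allI impI)
  fix V and M N :: "'a set \<Rightarrow> 'a set \<Rightarrow> 'r"
  let ?A = "{a1, a2}" and ?B = "{b}" and ?D = "{a1, a2} \<union> {b}"
  assume V: "0 \<in> V" and M: "entries_in (A \<union> ?A) (B \<union> ?B) V M" and N: "entries_in (B \<union> ?B) (A \<union> ?A) V N"
  have disj: "(A \<union> B) \<inter> ?D = {}" using new by auto
  let ?p = "\<lambda>X Y. masked_product A B (\<lambda>P S. M (P \<union> (X \<inter> ?A)) (S \<union> Y)) (\<lambda>Q S. N (Q \<union> (X \<inter> ?B)) (S \<union> Y))"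
  \<comment> \<open>\<open>E X\<close> holds the inner indices whose partial sums are delivered by
    Strassen's block product.\<close>
  define E where "E X = (if a1 \<in> X then {{}, {a1}} else {})" for X
  define K where "K = (SIGMA X:Pow ?D. Pow X - E X)"
  have "card K = 19"
  proof -
    \<comment> \<open>\<open>Q\<close> consists of the 8 pairs left to Strassen: 4 sets
      \<open>X\<close> containing \<open>a1\<close>, each with 2 choices of \<open>Y\<close>.
      Removing them from the 27 pairs leaves 19.\<close>
    define Q where "Q = (SIGMA X:insert a1 ` Pow {a2, b}. {{}, {a1}})"
    have K: "K = (SIGMA X:Pow ?D. Pow X) - Q"
    proof -
      have "insert a1 ` Pow {a2, b} = {X \<in> Pow ?D. a1 \<in> X}"
      proof (intro equalityI subsetI)
        fix X assume "X \<in> {X \<in> Pow ?D. a1 \<in> X}"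
        then have "X = insert a1 (X - {a1})" "X - {a1} \<in> Pow {a2, b}" by auto
        then show "X \<in> insert a1 ` Pow {a2, b}" by (rule image_eqI)
      qed auto
      then have "Q = (SIGMA X:{X \<in> Pow ?D. a1 \<in> X}. {{}, {a1}})" unfolding Q_def by (rule arg_cong)
      then show ?thesis unfolding K_def E_def by (simp only: set_eq_iff) (simp split: if_splits, blast)
    qed
    have "Q \<subseteq> (SIGMA X:Pow ?D. Pow X)" unfolding Q_def by auto
    moreover have "finite Q" unfolding Q_def by auto
    moreover have "card Q = 8"
    proof -
      have "inj_on (insert a1) (Pow {a2, b})"
        by (rule inj_onI, subst (asm) insert_ident) (use dist in auto)
      then have "card (insert a1 ` Pow {a2, b}) = 4" using dist by (simp add: card_image card_Pow)
      then show ?thesis unfolding Q_def by (subst card_SigmaI) (auto simp: card_insert_if)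
    qed
    moreover have "card (SIGMA X:Pow ?D. Pow X) = 27"
      using dist by (subst card_subset_pairs) (auto simp: card_insert_if)
    ultimately show ?thesis unfolding K by (simp add: card_Diff_subset)
  qed
  define Z where "Z = (\<Union>(X, Y)\<in>K. ?p X Y ` Pow (A \<union> B))"
  have "cost_le V (card K * c) Z" unfolding Z_def
    by (rule product_cost_blocks[OF pc V _ M N disj]) (auto simp: K_def)
  then have Z: "cost_le V (19 * c) Z" by (simp add: \<open>card K = 19\<close>)

  define X where "X i l = insert a1 ((if i then {a2} else {}) \<union> (if l then {b} else {}))" for i l
  define Y where "Y j = (if j then {a1} else {})" for j
  \<comment> \<open>The left factor sees \<open>X\<close> only through \<open>a1\<close> and
    \<open>a2\<close>, the right factor only through \<open>b\<close>. So the left block does not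
    depend on the column \<open>l\<close>, nor the right block on the row \<open>i\<close>. Since
    \<open>a1\<close> lies in every \<open>X i l\<close>, both values of \<open>Y j\<close> are
    always admissible and no block is missing.\<close>
  define M' where "M' i j = (\<lambda>P S. M (P \<union> (X i False \<inter> ?A)) (S \<union> Y j))" for i j
  define N' where "N' j l = (\<lambda>Q S. N (Q \<union> (X False l \<inter> ?B)) (S \<union> Y j))" for j l
  have XY: "X i l \<subseteq> ?D" "Y j \<subseteq> X i l" for i j l unfolding X_def Y_def by auto
  have M': "entries_in A B V (M' i j)" for i j
    unfolding M'_def using entries_in_block[OF M XY disj] .
  have N': "entries_in B A V (N' j l)" for j l
    unfolding N'_def using XY(1)[of False l] XY(2) disj by (intro entries_in_block[OF N]) auto
  let ?C = "\<lambda>(i, l, T). masked_product A B (M' i False) (N' False l) T + masked_product A B (M' i True) (N' True l) T"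
  define G where "G = ?C ` (UNIV \<times> UNIV \<times> Pow (A \<union> B))"
  have G: "cost_le V (7 * c + 5 * card (mask A B) + 5 * card (mask B A) + 12 * 2 ^ card (A \<union> B)) G"
    unfolding G_def using cost_le_strassen[OF fin pc V M' N'] .
  have C: "?C (a2 \<in> X0, b \<in> X0, T) = (\<Sum>Y\<in>E X0. ?p X0 Y T)" if "a1 \<in> X0" "X0 \<subseteq> ?D" for X0 T
  proof -
    have "X (a2 \<in> X0) False \<inter> ?A = X0 \<inter> ?A" "X False (b \<in> X0) \<inter> ?B = X0 \<inter> ?B"
      using that dist unfolding X_def by auto
    then show ?thesis using that(1) unfolding M'_def N'_def E_def Y_def by simp
  qed

  define W where "W = V \<union> (Z \<union> G)"
  let ?J = "Pow ?D \<times> Pow (A \<union> B)"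
  let ?g = "\<lambda>(X, T). masked_product (A \<union> ?A) (B \<union> ?B) M N (T \<union> X)"
  \<comment> \<open>At most 8 additions sum the separately computed products, and one more adds
    Strassen's part. Over 8 sets \<open>X\<close> this gives the 72 that, with the 12 from
    \<open>cost_le_strassen\<close>, makes 84.\<close>
  have "cost_le W 9 {?g j}" if j: "j \<in> ?J" for j
  proof -
    obtain X T where [simp]: "j = (X, T)" by (cases j)
    have X: "X \<subseteq> ?D" "T \<subseteq> A \<union> B" using j by auto
    have finT: "finite T" "finite X" using X fin by (auto intro: finite_subset)
    have EX: "E X \<subseteq> Pow X" unfolding E_def by auto
    have "?g j = (\<Sum>Y\<in>Pow X. ?p X Y T)"
      using masked_product_split[OF finT X(2,1) disj, of M N] by simp
    also have "\<dots> = (\<Sum>Y\<in>Pow X - E X. ?p X Y T) + (\<Sum>Y\<in>E X. ?p X Y T)"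
      using finT EX by (intro sum.subset_diff) auto
    finally have g: "?g j = (\<Sum>Y\<in>Pow X - E X. ?p X Y T) + (\<Sum>Y\<in>E X. ?p X Y T)" .
    have "cost_le W (card (Pow X - E X)) {\<Sum>Y\<in>Pow X - E X. ?p X Y T}"
      using X finT V by (intro cost_le_sum) (auto simp: Z_def K_def W_def)
    moreover have "card (Pow X - E X) \<le> 8"
    proof -
      have "card (Pow X - E X) \<le> card (Pow ?D)" using X by (intro card_mono) auto
      also have "\<dots> = 8" using dist by (subst card_Pow) (auto simp: card_insert_if)
      finally show ?thesis .
    qed
    ultimately have 1: "cost_le W 8 {\<Sum>Y\<in>Pow X - E X. ?p X Y T}"
      using cost_le_mono by blast
    have "(\<Sum>Y\<in>E X. ?p X Y T) \<in> W"
    proof (cases "a1 \<in> X")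
      case True
      have "?C (a2 \<in> X, b \<in> X, T) \<in> G" unfolding G_def using X by (intro imageI) auto
      then show ?thesis using C[OF True X(1)] unfolding W_def by auto
    next
      case False
      then show ?thesis using V by (simp add: E_def W_def)
    qed
    then have "cost_le W 0 {\<Sum>Y\<in>E X. ?p X Y T}" by (intro cost_le_subset) auto
    from cost_le_add[OF 1 this] show ?thesis unfolding g by simp
  qed
  then have 1: "cost_le W (card ?J * 9) (?g ` ?J)"
    using fin by (intro cost_le_image) auto
  have 2: "card ?J * 9 = 72 * 2 ^ card (A \<union> B)"
    using fin dist by (simp add: card_cartesian_product card_Pow card_insert_if)
  have 3: "masked_product (A \<union> ?A) (B \<union> ?B) M N ` Pow (A \<union> ?A \<union> (B \<union> ?B)) \<subseteq> ?g ` ?J"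
  proof (rule image_subsetI)
    fix T assume "T \<in> Pow (A \<union> ?A \<union> (B \<union> ?B))"
    then have "(T \<inter> ?D, T - ?D) \<in> ?J" "(T - ?D) \<union> (T \<inter> ?D) = T" by auto
    then show "masked_product (A \<union> ?A) (B \<union> ?B) M N T \<in> ?g ` ?J"
      by (intro image_eqI[of _ _ "(T \<inter> ?D, T - ?D)"]) simp_all
  qed
  have "cost_le W (72 * 2 ^ card (A \<union> B))
      (masked_product (A \<union> ?A) (B \<union> ?B) M N ` Pow (A \<union> ?A \<union> (B \<union> ?B)))"
    by (rule cost_le_mono[OF 1 order_refl eq_refl[OF 2] 3])
  from cost_le_trans'[OF cost_le_Un[OF Z G] this[unfolded W_def]]
  show "cost_le V (26 * c + 5 * card (mask A B) + 5 * card (mask B A) + 84 * 2 ^ card (A \<union> B))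
      (masked_product (A \<union> ?A) (B \<union> ?B) M N ` Pow (A \<union> ?A \<union> (B \<union> ?B)))"
    by (rule cost_le_mono) auto
qed

section \<open>The recurrence and its solution\<close>

text \<open>
  A solution of the recurrence with factor 26 whose linear overhead grows only like \<open>18 ^ k\<close>;
  the subtraction never truncates.
\<close>

definition product_bound :: "nat \<Rightarrow> nat" where
  "product_bound k = 80 * 26 ^ k - 51 * 18 ^ k"

text \<open>The overhead of a triple step is at most \<open>5 * 9 + 5 * 4 + 84 * 4 = 401\<close>
  times \<open>18 ^ k\<close>. The subtracted term gains \<open>51 * (26 - 18) = 408\<close> times
  \<open>18 ^ k\<close>, which covers it; then \<open>80 = 51 + 29\<close> fits the base
  case.\<close>

lemma product_bound_Suc: "26 * product_bound k + 401 * 18 ^ k \<le> product_bound (Suc k)"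
proof -
  have "(18::nat) ^ k \<le> 26 ^ k" by (rule power_mono) auto
  then show ?thesis unfolding product_bound_def by simp
qed

text \<open>The masks grow like \<open>3 ^ (2 * k) * 2 ^ k = 18 ^ k\<close> and
  \<open>3 ^ k * 2 ^ (2 * k) = 12 ^ k\<close>. The \<open>r\<close> extra elements of
  \<open>A\<close> contribute the factors 9 and 4.\<close>

lemma card_mask_balanced:
  assumes fin: "finite A" "finite B" and card: "card A = 2 * k + r" "card B = k" "r \<le> 2"
  shows "card (mask A B) \<le> 9 * 18 ^ k" "card (mask B A) \<le> 4 * 18 ^ k"
proof -
  have eqs: "18 ^ k = (3::nat) ^ (2 * k) * 2 ^ k" "12 ^ k = (3::nat) ^ k * 2 ^ (2 * k)"
    by (simp_all add: power_mult power_mult_distrib[symmetric])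
  have "3 ^ r * 18 ^ k = (3::nat) ^ (2 * k + r) * 2 ^ k" "2 ^ r * 12 ^ k = (3::nat) ^ k * 2 ^ (2 * k + r)"
    by (simp_all only: eqs power_add mult_ac)
  then have "card (mask A B) \<le> 3 ^ r * 18 ^ k" "card (mask B A) \<le> 2 ^ r * 12 ^ k"
    using card_mask(2)[OF fin] card_mask(2)[OF fin(2,1)] unfolding card(1,2) by simp_all
  moreover have "(3::nat) ^ r * 18 ^ k \<le> 9 * 18 ^ k"
    using power_increasing[OF card(3), of "3::nat"] by simp
  moreover have "(2::nat) ^ r * 12 ^ k \<le> 4 * 18 ^ k"
    using power_increasing[OF card(3), of "2::nat"] by (intro mult_le_mono power_mono) auto
  ultimately show "card (mask A B) \<le> 9 * 18 ^ k" "card (mask B A) \<le> 4 * 18 ^ k" by linarith+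
qed

text \<open>The remainder of \<open>r\<close> elements goes entirely into \<open>A\<close> at the
  start; each induction step then adds two elements to \<open>A\<close> and one to
  \<open>B\<close>.\<close>

lemma exists_balanced_split:
  assumes "finite W" "card W = 3 * k + r" "r \<le> 2"
  shows "\<exists>A B. A \<union> B = W \<and> A \<inter> B = {} \<and> card A = 2 * k + r \<and> card B = k \<and>
    product_cost TYPE('r::comm_ring_1) A B (product_bound k)"
  using assms(1,2)
proof (induction k arbitrary: W)
  case 0
  \<comment> \<open>Starting from cost 1, one insertion gives \<open>3 * 1 + 4 = 7\<close> and a
    second gives \<open>3 * 7 + 4 * 2 = 29\<close>, the largest of the three base cases.\<close>
  have bound: "product_bound 0 = 29" by (simp add: product_bound_def)
  have pc1: "product_cost TYPE('r) {a} {} 7" for a :: 'a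
    using product_cost_insert[OF product_cost_empty, of a] by simp
  have "product_cost TYPE('r) W {} 29"
  proof -
    consider "card W = 0" | "card W = 1" | "card W = 2" using 0 assms(3) by linarith
    then show ?thesis
    proof cases
      case 1
      then show ?thesis using 0 product_cost_mono[OF product_cost_empty[where 'r = 'r and 'u = 'a]] by auto
    next
      case 2
      then obtain a where "W = {a}" by (auto simp: card_1_singleton_iff)
      then show ?thesis using product_cost_mono[OF pc1] by auto
    next
      case 3
      then obtain a b where "W = {a, b}" "a \<noteq> b" by (auto simp: card_2_iff)
      then show ?thesis using product_cost_insert[OF pc1[of b], of a] by auto
    qed
  qed
  then show ?case using 0 by (intro exI[of _ W] exI[of _ "{}"]) (simp add: bound)
next
  case (Suc k)
  obtain D where D: "D \<subseteq> W" "card D = 3" "finite D"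
    using obtain_subset_with_card_n[of 3 W] Suc.prems by auto
  then obtain a1 a2 b where abc: "D = {a1, a2, b}" "a1 \<noteq> a2" "a1 \<noteq> b" "a2 \<noteq> b"
    by (auto simp: card_3_iff)
  have "card (W - D) = 3 * k + r" using D Suc.prems by (simp add: card_Diff_subset)
  then obtain A B where AB: "A \<union> B = W - D" "A \<inter> B = {}" "card A = 2 * k + r" "card B = k"
      "product_cost TYPE('r) A B (product_bound k)"
    using Suc.IH[of "W - D"] Suc.prems by auto
  have fin: "finite A" "finite B" using AB(1) Suc.prems(1) by (metis finite_Diff finite_Un)+
  have new: "{a1, a2, b} \<inter> (A \<union> B) = {}" using AB(1) abc(1) by auto
  note card_mask_balanced[OF fin AB(3,4) assms(3)]
  moreover have "2 ^ card (A \<union> B) \<le> 4 * (18::nat) ^ k"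
  proof -
    have "2 ^ card (A \<union> B) = 2 ^ r * (8::nat) ^ k"
      using \<open>card (W - D) = 3 * k + r\<close> unfolding AB(1) by (simp add: power_add power_mult)
    also have "\<dots> \<le> 4 * 18 ^ k"
      using power_increasing[OF assms(3), of "2::nat"] by (intro mult_le_mono power_mono) auto
    finally show ?thesis .
  qed
  ultimately have "26 * product_bound k + 5 * card (mask A B) + 5 * card (mask B A)
      + 84 * 2 ^ card (A \<union> B) \<le> product_bound (Suc k)"
    using product_bound_Suc[of k] by linarith
  from product_cost_mono[OF product_cost_triple[OF AB(5) fin new abc(2-4)] this]
  have "product_cost TYPE('r) (A \<union> {a1, a2}) (B \<union> {b}) (product_bound (Suc k))" .
  moreover have "(A \<union> {a1, a2}) \<union> (B \<union> {b}) = W" using AB(1) D(1) abc(1) by auto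
  moreover have "(A \<union> {a1, a2}) \<inter> (B \<union> {b}) = {}" using AB(2) new abc by auto
  moreover have "card (A \<union> {a1, a2}) = 2 * Suc k + r" "card (B \<union> {b}) = Suc k"
    using new abc fin AB(3,4) by (simp_all add: card_insert_if)
  ultimately show ?case by blast
qed

section \<open>The transform as a masked product, and the asymptotic bound\<close>

lemma prod_fun_apply: "(\<Prod>i\<in>A. f i) x = (\<Prod>i\<in>A. (f i x :: 'a::comm_ring_1))"
  by (induction A rule: infinite_finite_induct) auto

lemma sum_fun_apply: "(\<Sum>i\<in>A. f i) x = (\<Sum>i\<in>A. (f i x :: 'a::comm_ring_1))"
  by (induction A rule: infinite_finite_induct) auto

text \<open>The first term pays for the entries of both factors (\<open>13 = 9 + 4\<close>, with at
  most \<open>n\<close> multiplications per entry), the second for the masked product.\<close>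

definition transform_bound :: "nat \<Rightarrow> nat" where
  "transform_bound n = 13 * n * 18 ^ (n div 3) + 80 * 26 ^ (n div 3)"

lemma multi_subset_transform_program:
  fixes U :: "'u set"
  assumes "finite U"
  shows "\<exists>P :: ('u \<times> 'u set) program. length P \<le> transform_bound (card U) \<and>
    computes (U \<times> Pow U) (Pow U)
      (\<lambda>x :: 'u \<times> 'u set \<Rightarrow> 'a::comm_ring_1. multi_subset_transform (curry x)) P"
proof (rule computes_of_cost_le)
  let ?V = "input_functions (U \<times> Pow U) :: (('u \<times> 'u set \<Rightarrow> 'a) \<Rightarrow> 'a) set"
  define k r where "k = card U div 3" "r = card U mod 3"
  then have kr: "card U = 3 * k + r" "r \<le> 2" by auto
  \<comment> \<open>The product bound is taken over the ring of functions of the input, so the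
    result is an identity for all inputs.\<close>
  obtain A B where AB: "A \<union> B = U" "A \<inter> B = {}" "card A = 2 * k + r" "card B = k"
      "product_cost TYPE(('u \<times> 'u set \<Rightarrow> 'a) \<Rightarrow> 'a) A B (product_bound k)"
    using exists_balanced_split[OF assms kr] by blast
  have fin: "finite A" "finite B" using AB(1) assms by auto
  \<comment> \<open>The same \<open>M\<close> serves as left and right factor; only the masks on
    which it is needed differ.\<close>
  define M :: "'u set \<Rightarrow> 'u set \<Rightarrow> ('u \<times> 'u set \<Rightarrow> 'a) \<Rightarrow> 'a"
    where "M P S = (\<Prod>i\<in>P. (\<lambda>x. x (i, S)))" for P S
  have M: "cost_le ?V (card (mask A B) * card U) ((\<lambda>(P, S). M P S) ` mask A B)"
    if "A \<union> B = U" "finite A" "finite B" for A B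
  proof (rule cost_le_image[OF card_mask(1)[OF that(2,3)]])
    fix z assume z: "z \<in> mask A B"
    obtain P S where [simp]: "z = (P, S)" by (cases z)
    have PS: "P \<subseteq> U" "S \<subseteq> U" using z that by (auto simp: mask_def)
    have "cost_le ?V (card P) {M P S}" unfolding M_def
      using PS assms by (intro cost_le_prod) (auto simp: input_functions_def intro: finite_subset)
    then show "cost_le ?V (card U) {case z of (P, S) \<Rightarrow> M P S}"
      using cost_le_mono[OF _ order_refl card_mono[OF assms PS(1)]] by auto
  qed
  define W where "W = (\<lambda>(P, S). M P S) ` mask A B \<union> (\<lambda>(P, S). M P S) ` mask B A"
  have W: "cost_le ?V (card (mask A B) * card U + card (mask B A) * card U) W"
    unfolding W_def using AB(1) fin by (intro cost_le_Un M) auto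
  have "cost_le (?V \<union> W) (product_bound k) (masked_product A B M M ` Pow (A \<union> B))"
    by (rule product_costD[OF AB(5)]) (auto simp: W_def input_functions_def entries_in_def)
  from cost_le_trans'[OF W this]
  have "cost_le ?V (card (mask A B) * card U + card (mask B A) * card U + product_bound k)
    (masked_product A B M M ` Pow U)" unfolding AB(1) .
  moreover have "masked_product A B M M T = (\<lambda>x :: 'u \<times> 'u set \<Rightarrow> 'a. multi_subset_transform (curry x) T)"
    if "T \<subseteq> U" for T
  proof
    fix x :: "'u \<times> 'u set \<Rightarrow> 'a"
    have "(\<Prod>i\<in>T. x (i, S)) = (\<Prod>i\<in>T \<inter> A. x (i, S)) * (\<Prod>i\<in>T \<inter> B. x (i, S))" for S
    proof -
      have "T = (T \<inter> A) \<union> (T \<inter> B)" using that AB(1) by auto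
      then show ?thesis using fin AB(2) prod.union_disjoint[of "T \<inter> A" "T \<inter> B" "\<lambda>i. x (i, S)"] by auto
    qed
    then show "masked_product A B M M T x = multi_subset_transform (curry x) T"
      by (simp add: masked_product_def multi_subset_transform_def M_def sum_fun_apply prod_fun_apply)
  qed
  moreover have "card (mask A B) * card U + card (mask B A) * card U + product_bound k
      \<le> transform_bound (card U)"
  proof -
    have 1: "card (mask A B) * card U \<le> 9 * 18 ^ k * card U"
      "card (mask B A) * card U \<le> 4 * 18 ^ k * card U"
      by (intro mult_le_mono1 card_mask_balanced[OF fin AB(3,4) kr(2)])+
    have "product_bound k \<le> 80 * 26 ^ k" by (simp add: product_bound_def)
    moreover have "9 * 18 ^ k * card U + 4 * 18 ^ k * card U = 13 * card U * 18 ^ k"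
      by (simp add: algebra_simps)
    ultimately show ?thesis using 1 unfolding transform_bound_def k_r_def(1)[symmetric] by linarith
  qed
  ultimately show "cost_le ?V (transform_bound (card U))
      ((\<lambda>T x. multi_subset_transform (curry x) T) ` Pow U)"
    by (auto elim!: cost_le_mono)
qed

lemma transform_bound_bigo: "(\<lambda>n. real (transform_bound n)) \<in> O(\<lambda>n. 2.985 ^ n)"
\<comment> \<open>The estimate below gives 197; the constant 223 leaves slack.\<close>
proof (rule bigoI[of _ 223])
  \<comment> \<open>The gap between 18 and 26 absorbs the linear factor. The shift by 3 makes the
    induction step work from \<open>n = 0\<close>, where it needs \<open>18 \<le> 8 * 3\<close>, and
    also gives \<open>n \<le> 3 * (n div 3 + 3)\<close>.\<close>
  have lin: "(n + 3) * 18 ^ n \<le> 3 * (26::nat) ^ n" for n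
  proof (induction n)
    case (Suc n)
    have "(Suc n + 3) * 18 ^ Suc n = 18 * ((n + 3) * 18 ^ n) + 18 * (18::nat) ^ n"
      by (simp add: algebra_simps)
    moreover have "18 * 18 ^ n \<le> 8 * ((n + 3) * (18::nat) ^ n)" by (simp add: algebra_simps)
    moreover have "3 * (26::nat) ^ Suc n = 26 * (3 * 26 ^ n)" by simp
    ultimately show ?case using Suc by linarith
  qed simp
  have "norm (real (transform_bound n)) \<le> 223 * norm ((2.985::real) ^ n)" for n
  proof -
    let ?k = "n div 3"
    have "n * 18 ^ ?k \<le> 3 * ((?k + 3) * 18 ^ ?k)" by simp
    also have "\<dots> \<le> 9 * 26 ^ ?k" using lin[of ?k] by simp
    \<comment> \<open>Here \<open>197 = 13 * 9 + 80\<close>.\<close>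
    finally have "transform_bound n \<le> 197 * 26 ^ ?k" unfolding transform_bound_def by simp
    then have "real (transform_bound n) \<le> 197 * 26 ^ ?k"
      by (metis of_nat_le_iff of_nat_mult of_nat_numeral of_nat_power)
    also have "(26::real) ^ ?k \<le> (2.985 ^ 3) ^ ?k" by (intro power_mono) (simp_all add: power3_eq_cube)
    also have "\<dots> = 2.985 ^ (3 * ?k)" by (simp add: power_mult)
    also have "\<dots> \<le> 2.985 ^ n" by (intro power_increasing) auto
    finally show ?thesis by simp
  qed
  then show "eventually (\<lambda>n. norm (real (transform_bound n)) \<le> 223 * norm ((2.985::real) ^ n)) at_top"
    by simp
qed

theorem theorem1:
  "\<exists>t :: nat \<Rightarrow> nat.
     (\<lambda>n. real (t n)) \<in> O(\<lambda>n. 2.985 ^ n) \<and>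
     (\<forall>U :: 'u set. finite U \<longrightarrow>
        (\<exists>P :: ('u \<times> 'u set) program.
           length P \<le> t (card U) \<and>
           computes (U \<times> Pow U) (Pow U)
             (\<lambda>x :: 'u \<times> 'u set \<Rightarrow> 'a::comm_ring_1. multi_subset_transform (curry x)) P))"
  using transform_bound_bigo multi_subset_transform_program by blast

end
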